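(* Let $\mathbb X=\{X_Q\}_{Q\subset\mathbb R^n}$ be a family of quasi-Banach function spaces, $X_Q$ over $(Q,dx)$ for each cube $Q$, normalized in the sense that $c_0\le\|\chi_Q\|_{X_Q}\le C_0$ for all cubes $Q$ with constants $0<c_0\le C_0<\infty$. Let $\eta_0\in(0,1)$ and $C_n>0$ be the dimensional constants of the sparse domination principle for local $BMO$ oscillation (see the context). Assume that $T_{\mathbb X}(\eta_0)<\infty$. Then $$BMO\hookrightarrow BMO_{\mathbb X}.$$ More precisely, for every $f\in BMO$, $$\|f\|_{BMO_{\mathbb X}}\le C_n\,T_{\mathbb X}(\eta_0)\,\|f\|_{BMO}.$$
   Context: Cubes in $\mathbb R^n$ have sides parallel to the coordinate axes; functions are real-valued and measurable; $\langle f\rangle_Q=\frac1{|Q|}\int_Q f$. A quasi-Banach function space over a measure space $\Omega$ is a quasi-normed lattice $X\subset L^0(\Omega)$ such that: (1) if $|f|\le|g|$ a.e. and $g\in X$, then $f\in X$ and $\|f\|_X\le\|g\|_X$; (2) $\|f+g\|_X\le C_X(\|f\|_X+\|g\|_X)$ for some $C_X\ge1$; (3) (Fatou) if $0\le f_j\uparrow f$ a.e. and $\sup_j\|f_j\|_X<\infty$, then $f\in X$ and $\|f\|_X=\sup_j\|f_j\|_X$. The expression $\|g\chi_Q\|_{X_Q}$ denotes the $X_Q$-quasi-norm of the restriction of $g$ to $Q$ (value $+\infty$ if it is not in $X_Q$). $\mathcal D(Q)$ is the collection of dyadic subcubes of $Q$, obtained by repeatedly subdividing $Q$ into $2^n$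 congruent subcubes. For $\mathcal S\subset\mathcal D(Q)$ and $P\in\mathcal S$, $\operatorname{ch}_{\mathcal S}(P)$ is the collection of maximal cubes $R\in\mathcal S$ with $R\subsetneq P$. For $0<\eta<1$, $\mathcal S$ is $\eta$-sparse if $\sum_{R\in\operatorname{ch}_{\mathcal S}(P)}|R|\le(1-\eta)|P|$ for every $P\in\mathcal S$. The sparse testing seminorm is $$T_{\mathbb X}(\eta):=\sup_Q\ \sup_{\mathcal S\subset\mathcal D(Q),\ \mathcal S\ \eta\text{-sparse}}\Big\|\sum_{P\in\mathcal S}\chi_P\Big\|_{X_Q}.$$ $\|f\|_{BMO}:=\sup_Q\frac1{|Q|}\int_Q|f-\langle f\rangle_Q|\,dx$ and $\|f\|_{BMO_{\mathbb X}}:=\sup_Q\|(f-\langle f\rangle_Q)\chi_Q\|_{X_Q}$ for $f\in L^1_{\mathrm{loc}}(\mathbb R^n)$; $BMO$ and $BMO_{\mathbb X}$ consist of the locally integrable $f$ for which these are finite. $A\hookrightarrow B$ denotes continuous embedding (with respect to the seminorms). Sparse domination principle: $\eta_0\in(0,1)$ and $C_n>0$ denote constants depending only on $n$ with the property that for every $f\in BMO(\mathbb R^n)$ and every cube $Q$ there is an $\eta_0$-sparse family $\mathcal S\subset\mathcal D(Q)$ such that $|f(x)-\langle f\rangle_Q|\chi_Q(x)\le C_n\|f\|_{BMO}\sum_{P\in\mathcal S}\chi_P(x)$ for a.e. $x\in Q$ (such constants exist). *)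

theory Defs
  imports "HOL-Analysis.Analysis"
begin

section \<open>Quasi-Banach function spaces\<close>

text \<open>
  A function space over a measure space is given by its members and its quasi-norm. Members are
  functions rather than classes modulo a.e. equality; the ideal property below makes membership
  and quasi-norm invariant under a.e. equality. Over \<^term>\<open>lebesgue_on Q\<close> the values off \<open>Q\<close>
  are irrelevant, so \<open>g\<close> itself may stand for its restriction to \<open>Q\<close>.
\<close>

record 'a fun_space =
  members :: "('a \<Rightarrow> real) set"
  qnorm :: "('a \<Rightarrow> real) \<Rightarrow> real"

text \<open>
  Closure under the lattice operations is a consequence of closure under addition and of
  \<open>ideal\<close>; completeness is a consequence of \<open>Fatou\<close>.
\<close>

locale quasi_banach_function_space =
  fixes M :: "'a measure" and X :: "'a fun_space"
  assumes measurable: "members X \<subseteq> borel_measurable M"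
    and zero: "(\<lambda>_. 0) \<in> members X"
    and add: "\<lbrakk>f \<in> members X; g \<in> members X\<rbrakk> \<Longrightarrow> (\<lambda>x. f x + g x) \<in> members X"
    and scale: "f \<in> members X \<Longrightarrow> (\<lambda>x. c * f x) \<in> members X"
    and qnorm_nonneg: "f \<in> members X \<Longrightarrow> 0 \<le> qnorm X f"
    and qnorm_eq_0_iff: "f \<in> members X \<Longrightarrow> qnorm X f = 0 \<longleftrightarrow> (AE x in M. f x = 0)"
    and qnorm_scale: "f \<in> members X \<Longrightarrow> qnorm X (\<lambda>x. c * f x) = \<bar>c\<bar> * qnorm X f"
    and ideal:
      "\<lbrakk>f \<in> borel_measurable M; g \<in> members X; AE x in M. \<bar>f x\<bar> \<le> \<bar>g x\<bar>\<rbrakk>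
        \<Longrightarrow> f \<in> members X \<and> qnorm X f \<le> qnorm X g"
    and quasi_triangle:
      "\<exists>C\<ge>1. \<forall>f\<in>members X. \<forall>g\<in>members X.
        qnorm X (\<lambda>x. f x + g x) \<le> C * (qnorm X f + qnorm X g)"
    and Fatou:
      "\<lbrakk>\<And>j. u j \<in> members X; f \<in> borel_measurable M;
        AE x in M. (\<forall>j. 0 \<le> u j x) \<and> incseq (\<lambda>j. u j x) \<and> (\<lambda>j. u j x) \<longlonglongrightarrow> f x;
        bdd_above (range (\<lambda>j. qnorm X (u j)))\<rbrakk>
        \<Longrightarrow> f \<in> members X \<and> qnorm X f = (SUP j. qnorm X (u j))"

definition ext_qnorm :: "'a fun_space \<Rightarrow> ('a \<Rightarrow> real) \<Rightarrow> ennreal" where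
  "ext_qnorm X g = (if g \<in> members X then ennreal (qnorm X g) else \<infinity>)"

text \<open>
  The sum of the indicators of infinitely many cubes may be infinite at some points. An
  extended-valued function that is finite a.e. is identified with a real-valued one; one that is
  not finite a.e. belongs to no function space and has quasi-norm \<open>\<infinity>\<close>.
\<close>

definition ext_qnorm_ennreal :: "'a measure \<Rightarrow> 'a fun_space \<Rightarrow> ('a \<Rightarrow> ennreal) \<Rightarrow> ennreal" where
  "ext_qnorm_ennreal M X g =
    (if AE x in M. g x < \<infinity> then ext_qnorm X (\<lambda>x. enn2real (g x)) else \<infinity>)"


section \<open>Cubes and sparse families\<close>

text \<open>Cubes are taken half-open, so that subdivision yields exact partitions.\<close>

definition cube :: "real ^ 'n \<Rightarrow> real \<Rightarrow> (real ^ 'n) set" where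
  "cube a l = {x. \<forall>i. a $ i \<le> x $ i \<and> x $ i < a $ i + l}"

definition cubes :: "(real ^ 'n) set set" where
  "cubes = {cube a l | a l. 0 < l}"

inductive_set dyadic :: "(real ^ 'n) set \<Rightarrow> (real ^ 'n) set set"
  for Q :: "(real ^ 'n) set" where
  self: "Q \<in> dyadic Q"
| subdivide: "\<lbrakk>cube a l \<in> dyadic Q; 0 < l; \<forall>i. b $ i \<in> {a $ i, a $ i + l / 2}\<rbrakk>
    \<Longrightarrow> cube b (l / 2) \<in> dyadic Q"

definition ch :: "(real ^ 'n) set set \<Rightarrow> (real ^ 'n) set \<Rightarrow> (real ^ 'n) set set" where
  "ch S P = {R \<in> S. R \<subset> P \<and> \<not> (\<exists>R'\<in>S. R \<subset> R' \<and> R' \<subset> P)}"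

definition sparse :: "real \<Rightarrow> (real ^ 'n) set set \<Rightarrow> bool" where
  "sparse \<eta> S \<longleftrightarrow>
    (\<forall>P\<in>S. (\<Sum>\<^sub>\<infinity>R\<in>ch S P. emeasure lebesgue R) \<le> ennreal (1 - \<eta>) * emeasure lebesgue P)"

definition sparse_testing ::
    "((real ^ 'n) set \<Rightarrow> (real ^ 'n) fun_space) \<Rightarrow> real \<Rightarrow> ennreal" where
  "sparse_testing X \<eta> =
    (SUP Q\<in>cubes. SUP S\<in>{S. S \<subseteq> dyadic Q \<and> sparse \<eta> S}.
      ext_qnorm_ennreal (lebesgue_on Q) (X Q) (\<lambda>x. \<Sum>\<^sub>\<infinity>P\<in>S. indicator P x))"

definition normalized_family :: "((real ^ 'n) set \<Rightarrow> (real ^ 'n) fun_space) \<Rightarrow> bool" where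
  "normalized_family X \<longleftrightarrow>
    (\<exists>c\<^sub>0 C\<^sub>0. 0 < c\<^sub>0 \<and> c\<^sub>0 \<le> C\<^sub>0 \<and>
      (\<forall>Q\<in>cubes. ennreal c\<^sub>0 \<le> ext_qnorm (X Q) (indicator Q) \<and>
        ext_qnorm (X Q) (indicator Q) \<le> ennreal C\<^sub>0))"


section \<open>Mean oscillation\<close>

definition locally_integrable :: "(real ^ 'n \<Rightarrow> real) \<Rightarrow> bool" where
  "locally_integrable f \<longleftrightarrow>
    f \<in> borel_measurable lebesgue \<and> (\<forall>K. compact K \<longrightarrow> integrable (lebesgue_on K) f)"

definition avg :: "(real ^ 'n) set \<Rightarrow> (real ^ 'n \<Rightarrow> real) \<Rightarrow> real" where
  "avg Q f = 1 / measure lebesgue Q * integral\<^sup>L (lebesgue_on Q) f"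

definition bmo_norm :: "(real ^ 'n \<Rightarrow> real) \<Rightarrow> ennreal" where
  "bmo_norm f = (SUP Q\<in>cubes. ennreal (avg Q (\<lambda>x. \<bar>f x - avg Q f\<bar>)))"

definition bmo_norm_of ::
    "((real ^ 'n) set \<Rightarrow> (real ^ 'n) fun_space) \<Rightarrow> (real ^ 'n \<Rightarrow> real) \<Rightarrow> ennreal" where
  "bmo_norm_of X f = (SUP Q\<in>cubes. ext_qnorm (X Q) (\<lambda>x. (f x - avg Q f) * indicator Q x))"

definition BMO :: "(real ^ 'n \<Rightarrow> real) set" where
  "BMO = {f. locally_integrable f \<and> bmo_norm f < \<infinity>}"

definition BMO_of :: "((real ^ 'n) set \<Rightarrow> (real ^ 'n) fun_space) \<Rightarrow> (real ^ 'n \<Rightarrow> real) set" where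
  "BMO_of X = {f. locally_integrable f \<and> bmo_norm_of X f < \<infinity>}"

definition continuously_embedded ::
    "'f set \<Rightarrow> ('f \<Rightarrow> ennreal) \<Rightarrow> 'f set \<Rightarrow> ('f \<Rightarrow> ennreal) \<Rightarrow> bool" where
  "continuously_embedded A p B q \<longleftrightarrow>
    A \<subseteq> B \<and> (\<exists>K::real. 0 \<le> K \<and> (\<forall>f\<in>A. q f \<le> ennreal K * p f))"

text \<open>
  The type argument carries the dimension, on which alone the constants of the sparse domination
  principle depend.
\<close>

definition sparse_domination :: "'n::finite itself \<Rightarrow> real \<Rightarrow> real \<Rightarrow> bool" where
  "sparse_domination _ \<eta> C \<longleftrightarrow>
    (\<forall>f\<in>(BMO :: (real ^ 'n \<Rightarrow> real) set). \<forall>Q\<in>cubes. \<exists>S \<subseteq> dyadic Q. sparse \<eta> S \<and>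
      (AE x in lebesgue_on Q.
        ennreal (\<bar>f x - avg Q f\<bar> * indicator Q x)
          \<le> ennreal C * bmo_norm f * (\<Sum>\<^sub>\<infinity>P\<in>S. indicator P x)))"

end

theory Submission
  imports Defs
begin

text \<open>
  Two properties of the spaces are at work: the lattice property and homogeneity. On a cube \<open>Q\<close>
  the sparse domination principle bounds the oscillation \<open>\<bar>f - avg Q f\<bar>\<close> pointwise by the multiple
  \<open>C\<^sub>n * bmo_norm f\<close> of a sum of indicators of an \<open>\<eta>\<^sub>0\<close>-sparse family of dyadic subcubes of \<open>Q\<close>,
  and the quasi-norm of that sum in \<open>X Q\<close> is at most \<open>sparse_testing X \<eta>\<^sub>0\<close> because the family
  competes in the supremum. The lattice property turns the pointwise bound into a bound of
  quasi-norms, and homogeneity takes the constant out.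

  The sum may be infinite at some points, which is where finiteness of the testing seminorm enters:
  it forces the sum to be finite almost everywhere and its real-valued version to be a member of
  \<open>X Q\<close>, so that it can serve as a majorant there. The bound thus holds on every cube with the
  same constant, and the supremum over cubes yields both the norm inequality and the embedding.
\<close>

text \<open>
  The lattice property and homogeneity combined, for a majorant with values in \<open>[0, \<infinity>]\<close>. A finite
  quasi-norm means that \<open>g\<close> is finite almost everywhere and that its real-valued version is a
  member of \<open>X\<close>; where \<open>g\<close> and \<open>c\<close> are finite, the bound passes from \<open>ennreal\<close> to the reals.
\<close>

lemma (in quasi_banach_function_space) ext_qnorm_le_scaled_majorant:
  fixes g :: "'a \<Rightarrow> ennreal" and c :: ennreal
  assumes h: "h \<in> borel_measurable M"
    and c: "c < \<infinity>"
    and g: "ext_qnorm_ennreal M X g < \<infinity>"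
    and le: "AE x in M. ennreal \<bar>h x\<bar> \<le> c * g x"
  shows "ext_qnorm X h \<le> c * ext_qnorm_ennreal M X g"
proof -
  let ?g = "\<lambda>x. enn2real (g x)" and ?c = "enn2real c"
  have fin: "AE x in M. g x < \<infinity>"
    using g unfolding ext_qnorm_ennreal_def by (auto split: if_splits)
  have mem: "?g \<in> members X"
    using g fin unfolding ext_qnorm_ennreal_def ext_qnorm_def by (auto split: if_splits)
  have norm_g: "ext_qnorm_ennreal M X g = ennreal (qnorm X ?g)"
    using fin mem unfolding ext_qnorm_ennreal_def ext_qnorm_def by simp
  have "AE x in M. \<bar>h x\<bar> \<le> \<bar>?c * ?g x\<bar>"
    using le fin
  proof eventually_elim
    case (elim x)
    have "c * g x < \<infinity>" using c elim(2) by (simp add: ennreal_mult_less_top)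
    then have "enn2real (ennreal \<bar>h x\<bar>) \<le> enn2real (c * g x)"
      using elim(1) by (intro enn2real_mono) auto
    then show ?case by (simp add: enn2real_mult)
  qed
  from ideal[OF h scale[OF mem] this]
  have "h \<in> members X" and "qnorm X h \<le> ?c * qnorm X ?g"
    by (simp_all add: qnorm_scale[OF mem])
  then have "ext_qnorm X h \<le> ennreal (?c * qnorm X ?g)"
    unfolding ext_qnorm_def by (simp add: ennreal_leI)
  also have "\<dots> = c * ext_qnorm_ennreal M X g"
    using c qnorm_nonneg[OF mem] by (simp add: norm_g ennreal_mult)
  finally show ?thesis .
qed

lemma ext_qnorm_ennreal_le_sparse_testing:
  assumes "Q \<in> cubes" and "S \<subseteq> dyadic Q" and "sparse \<eta> S"
  shows "ext_qnorm_ennreal (lebesgue_on Q) (X Q) (\<lambda>x. \<Sum>\<^sub>\<infinity>P\<in>S. indicator P x)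
    \<le> sparse_testing X \<eta>"
  unfolding sparse_testing_def using assms by (intro SUP_upper2[of Q] SUP_upper) auto

lemma ext_qnorm_oscillation_le:
  fixes X :: "(real ^ 'n) set \<Rightarrow> (real ^ 'n) fun_space"
  assumes X: "quasi_banach_function_space (lebesgue_on Q) (X Q)"
    and dom: "sparse_domination TYPE('n) \<eta> C"
    and T: "sparse_testing X \<eta> < \<infinity>"
    and f: "f \<in> BMO" and Q: "Q \<in> cubes"
  shows "ext_qnorm (X Q) (\<lambda>x. (f x - avg Q f) * indicator Q x)
    \<le> ennreal C * bmo_norm f * sparse_testing X \<eta>"
proof -
  obtain S where S: "S \<subseteq> dyadic Q" "sparse \<eta> S"
    and le: "AE x in lebesgue_on Q. ennreal (\<bar>f x - avg Q f\<bar> * indicator Q x)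
      \<le> ennreal C * bmo_norm f * (\<Sum>\<^sub>\<infinity>P\<in>S. indicator P x)"
    using dom f Q unfolding sparse_domination_def by blast
  let ?g = "\<lambda>x. \<Sum>\<^sub>\<infinity>P\<in>S. indicator P x :: ennreal"
  have test: "ext_qnorm_ennreal (lebesgue_on Q) (X Q) ?g \<le> sparse_testing X \<eta>"
    using ext_qnorm_ennreal_le_sparse_testing Q S by blast
  have "f \<in> borel_measurable (lebesgue_on Q)"
    using f unfolding BMO_def locally_integrable_def by (auto intro: measurable_restrict_space1)
  then have "(\<lambda>x. f x - avg Q f) \<in> borel_measurable (lebesgue_on Q)"
    by simp
  then have "(\<lambda>x. (f x - avg Q f) * indicator Q x) \<in> borel_measurable (lebesgue_on Q)"
    by (rule measurable_cong[THEN iffD1, rotated]) (simp add: space_restrict_space)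
  moreover have "ennreal C * bmo_norm f < \<infinity>"
    using f unfolding BMO_def by (simp add: ennreal_mult_less_top)
  moreover have "ext_qnorm_ennreal (lebesgue_on Q) (X Q) ?g < \<infinity>"
    using test T by (rule le_less_trans)
  moreover have "AE x in lebesgue_on Q. ennreal \<bar>(f x - avg Q f) * indicator Q x\<bar>
      \<le> ennreal C * bmo_norm f * ?g x"
    using le by (simp add: abs_mult)
  ultimately have "ext_qnorm (X Q) (\<lambda>x. (f x - avg Q f) * indicator Q x)
      \<le> ennreal C * bmo_norm f * ext_qnorm_ennreal (lebesgue_on Q) (X Q) ?g"
    by (rule quasi_banach_function_space.ext_qnorm_le_scaled_majorant[OF X])
  also have "\<dots> \<le> ennreal C * bmo_norm f * sparse_testing X \<eta>"
    using test by (intro mult_left_mono) auto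
  finally show ?thesis .
qed

theorem theorem4p2:
  fixes X :: "(real ^ 'n) set \<Rightarrow> (real ^ 'n) fun_space"
    and \<eta>\<^sub>0 C\<^sub>n :: real
  assumes "\<And>Q. Q \<in> cubes \<Longrightarrow> quasi_banach_function_space (lebesgue_on Q) (X Q)"
    and "normalized_family X"
    and "0 < \<eta>\<^sub>0" and "\<eta>\<^sub>0 < 1" and "0 < C\<^sub>n"
    and "sparse_domination TYPE('n) \<eta>\<^sub>0 C\<^sub>n"
    and "sparse_testing X \<eta>\<^sub>0 < \<infinity>"
  shows "continuously_embedded BMO bmo_norm (BMO_of X) (bmo_norm_of X) \<and>
    (\<forall>f\<in>BMO. bmo_norm_of X f \<le> ennreal C\<^sub>n * sparse_testing X \<eta>\<^sub>0 * bmo_norm f)"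
proof -
  have bound: "bmo_norm_of X f \<le> ennreal C\<^sub>n * sparse_testing X \<eta>\<^sub>0 * bmo_norm f"
    if f: "f \<in> BMO" for f
    unfolding bmo_norm_of_def
  proof (rule SUP_least)
    fix Q :: "(real ^ 'n) set"
    assume Q: "Q \<in> cubes"
    show "ext_qnorm (X Q) (\<lambda>x. (f x - avg Q f) * indicator Q x)
        \<le> ennreal C\<^sub>n * sparse_testing X \<eta>\<^sub>0 * bmo_norm f"
      using ext_qnorm_oscillation_le[OF assms(1)[OF Q] assms(6,7) f Q]
      by (simp add: mult.commute mult.left_commute)
  qed
  define K where "K = C\<^sub>n * enn2real (sparse_testing X \<eta>\<^sub>0)"
  have "0 \<le> K"
    using assms(5) by (simp add: K_def)
  moreover have K: "ennreal K = ennreal C\<^sub>n * sparse_testing X \<eta>\<^sub>0"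
    using assms(5,7) by (simp add: K_def ennreal_mult)
  moreover have "f \<in> BMO_of X" if f: "f \<in> BMO" for f
  proof -
    have "ennreal K * bmo_norm f < \<infinity>"
      using f by (simp add: BMO_def ennreal_mult_less_top)
    then have "bmo_norm_of X f < \<infinity>"
      using bound[OF f] K by simp
    then show ?thesis
      using f by (simp add: BMO_def BMO_of_def)
  qed
  ultimately show ?thesis
    using bound unfolding continuously_embedded_def by (metis subsetI)
qed

end
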